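(* Let $\Gamma\subset SL_2(\mathbb R)$ be a Fuchsian group of the first kind and let $m\ge2$ be even. Let $f_1,\ldots,f_k\in M_m(\Gamma)$ be a sequence of linearly independent modular forms and let $\xi\in\mathbb H$. Then $$\nu_{\mathfrak a_\xi}\left(W(f_1,\ldots,f_k)\right)=\frac1{e_\xi}\cdot\left(\nu_{z-\xi}(f_1,\ldots,f_k)-\frac{k(k-1)}2\right).$$
   Context: A Fuchsian group of the first kind is a discrete subgroup $\Gamma\subset SL_2(\mathbb R)$ with $\iint_{\Gamma\backslash\mathbb H} dx\,dy/y^2<\infty$, $\mathbb H$ being the upper half-plane. For $g=\begin{pmatrix}a&b\\c&d\end{pmatrix}$ put $j(g,z)=cz+d$. $\mathfrak R_\Gamma$ is the compact Riemann surface obtained from $\Gamma\backslash\mathbb H$ by adding the finitely many $\Gamma$-orbits of cusps, and $\mathfrak a_\xi\in\mathfrak R_\Gamma$ is the image of $\xi\in\mathbb H$. $M_m(\Gamma)$ is the space of holomorphic $f:\mathbb H\to\mathbb C$ with $f(\gamma.z)=j(\gamma,z)^m f(z)$ for all $\gamma\in\Gamma$ that are holomorphic at every cusp of $\Gamma$. The Wronskian is $W(f_1,\ldots,f_k)=\det\left(\frac{d^{i-1}f_j}{dz^{i-1}}\right)_{1\le i,j\le k}$; it is a modular form for $\Gamma$ of weight $k(m+k-1)$, non-zero when $f_1,\ldots,f_k$ are linearly independent. Put $e_\xi=\#(\Gamma_\xi/(\Gamma\cap\{\pm1\}))$. For a non-zero modular form $f$ of even weight for $\Gamma$, $\nu_{\mathfrak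 a_\xi}(f)=\nu_{z-\xi}(f)/e_\xi$, where $\nu_{z-\xi}(f)$ is the order of vanishing of the holomorphic function $f$ at $\xi$. For linearly independent functions $\varphi_1,\ldots,\varphi_k$ holomorphic at $\xi$ with $\mathbb C$-span $A$, the set $\{\nu_{z-\xi}(\varphi):\varphi\in A,\ \varphi\ne0\}$ has exactly $k=\dim A$ different elements; $\nu_{z-\xi}(\varphi_1,\ldots,\varphi_k)$ denotes the sum of these $k$ values. *)

theory Defs
  imports
    "Jordan_Normal_Form.Determinant"
    "HOL-Algebra.Coset"
    "HOL-Complex_Analysis.Complex_Analysis"
begin

no_notation vec_index (infixl "$" 100)

definition upper_half_plane :: "complex set" where
  "upper_half_plane = {z. Im z > 0}"

definition SL2R :: "(real^2^2) monoid" where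
  "SL2R = \<lparr>carrier = {A. Determinants.det A = 1}, mult = (**), one = Finite_Cartesian_Product.mat 1\<rparr>"

lemma group_SL2R: "group SL2R"
proof (rule groupI)
  fix A assume A: "A \<in> carrier SL2R"
  hence "invertible A"
    by (simp add: SL2R_def invertible_det_nz)
  then obtain B where B: "A ** B = Finite_Cartesian_Product.mat 1" "B ** A = Finite_Cartesian_Product.mat 1"
    unfolding invertible_def by blast
  have "Determinants.det A * Determinants.det B = 1"
    using B(1) by (metis det_mul det_I)
  hence "B \<in> carrier SL2R"
    using A by (simp add: SL2R_def)
  thus "\<exists>B\<in>carrier SL2R. B \<otimes>\<^bsub>SL2R\<^esub> A = \<one>\<^bsub>SL2R\<^esub>"
    using B(2) by (auto simp: SL2R_def)
qed (auto simp: SL2R_def det_mul matrix_mul_assoc)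

definition automorphy :: "real^2^2 \<Rightarrow> complex \<Rightarrow> complex" where
  "automorphy g z = of_real (g $ 2 $ 1) * z + of_real (g $ 2 $ 2)"

definition moebius :: "real^2^2 \<Rightarrow> complex \<Rightarrow> complex" where
  "moebius g z = (of_real (g $ 1 $ 1) * z + of_real (g $ 1 $ 2)) / automorphy g z"

text \<open>The action of \<^term>\<open>SL2R\<close> on the boundary of the upper half-plane, that is, on the real
  line together with the point at infinity, which is represented by \<^term>\<open>None\<close>.\<close>

fun moebius_bdry :: "real^2^2 \<Rightarrow> real option \<Rightarrow> real option" where
  "moebius_bdry g None =
     (if g $ 2 $ 1 = 0 then None else Some (g $ 1 $ 1 / g $ 2 $ 1))"
| "moebius_bdry g (Some x) =
     (if g $ 2 $ 1 * x + g $ 2 $ 2 = 0 then None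
      else Some ((g $ 1 $ 1 * x + g $ 1 $ 2) / (g $ 2 $ 1 * x + g $ 2 $ 2)))"

definition hyperbolic_area :: "complex set \<Rightarrow> ennreal" where
  "hyperbolic_area F = (\<integral>\<^sup>+z\<in>F. ennreal (1 / (Im z)\<^sup>2) \<partial>lborel)"

text \<open>The area of the quotient of the upper half-plane by a discrete group is the hyperbolic
  area of any Borel set of representatives of the orbits; it does not depend on the choice of
  that set.\<close>

definition borel_representatives :: "(real^2^2) set \<Rightarrow> complex set \<Rightarrow> bool" where
  "borel_representatives \<Gamma> F \<longleftrightarrow>
     F \<in> sets borel \<and> F \<subseteq> upper_half_plane \<and>
     (\<forall>z\<in>upper_half_plane. \<exists>!w. w \<in> F \<and> (\<exists>\<gamma>\<in>\<Gamma>. w = moebius \<gamma> z))"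

definition fuchsian_first_kind :: "(real^2^2) set \<Rightarrow> bool" where
  "fuchsian_first_kind \<Gamma> \<longleftrightarrow>
     subgroup \<Gamma> SL2R \<and> discrete \<Gamma> \<and>
     (\<exists>F. borel_representatives \<Gamma> F \<and> hyperbolic_area F < \<infinity>)"

definition parabolic :: "real^2^2 \<Rightarrow> bool" where
  "parabolic g \<longleftrightarrow> g \<in> carrier SL2R \<and> \<bar>trace g\<bar> = 2 \<and>
     g \<noteq> Finite_Cartesian_Product.mat 1 \<and> g \<noteq> Finite_Cartesian_Product.mat (-1)"

definition is_cusp :: "(real^2^2) set \<Rightarrow> real option \<Rightarrow> bool" where
  "is_cusp \<Gamma> x \<longleftrightarrow> (\<exists>\<gamma>\<in>\<Gamma>. parabolic \<gamma> \<and> moebius_bdry \<gamma> x = x)"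

definition slash :: "nat \<Rightarrow> (complex \<Rightarrow> complex) \<Rightarrow> real^2^2 \<Rightarrow> complex \<Rightarrow> complex" where
  "slash m f \<sigma> z = f (moebius \<sigma> z) / automorphy \<sigma> z ^ m"

definition translation :: "real \<Rightarrow> real^2^2" where
  "translation h = vector [vector [1, h], vector [0, 1]]"

text \<open>A function \<open>f\<close> is holomorphic at a cusp \<open>x\<close> if, after moving \<open>x\<close> to infinity by some
  \<open>\<sigma>\<close>, its Fourier expansion has no terms of negative index, i.e. it is a holomorphic function
  of \<open>exp (2 \<pi> i z / h)\<close> on the whole unit disc, including the centre. Requiring the
  unsigned translation by \<open>h\<close> to lie in the conjugated group makes \<open>h\<close> a period in every
  weight, also at an irregular cusp; which of these periods is used makes no difference. If
  \<open>x\<close> is a cusp of a discrete group, such \<open>\<sigma>\<close> and \<open>h\<close> exist.\<close>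

definition holomorphic_at_cusp ::
    "nat \<Rightarrow> (real^2^2) set \<Rightarrow> (complex \<Rightarrow> complex) \<Rightarrow> real option \<Rightarrow> bool" where
  "holomorphic_at_cusp m \<Gamma> f x \<longleftrightarrow>
     (\<forall>\<sigma>\<in>carrier SL2R. \<forall>h>0.
        moebius_bdry \<sigma> None = x \<and>
        \<sigma> \<otimes>\<^bsub>SL2R\<^esub> translation h \<otimes>\<^bsub>SL2R\<^esub> inv\<^bsub>SL2R\<^esub> \<sigma> \<in> \<Gamma> \<longrightarrow>
        (\<exists>\<Phi>. \<Phi> holomorphic_on ball 0 1 \<and>
           (\<forall>z\<in>upper_half_plane.
              slash m f \<sigma> z = \<Phi> (exp (2 * of_real pi * \<i> * z / of_real h)))))"

text \<open>Functions on the upper half-plane are represented by total functions whose values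
  elsewhere are irrelevant.\<close>

definition modular_forms :: "nat \<Rightarrow> (real^2^2) set \<Rightarrow> (complex \<Rightarrow> complex) set" where
  "modular_forms m \<Gamma> =
     {f. f holomorphic_on upper_half_plane \<and>
         (\<forall>\<gamma>\<in>\<Gamma>. \<forall>z\<in>upper_half_plane. f (moebius \<gamma> z) = automorphy \<gamma> z ^ m * f z) \<and>
         (\<forall>x. is_cusp \<Gamma> x \<longrightarrow> holomorphic_at_cusp m \<Gamma> f x)}"

text \<open>A sequence of \<open>k\<close> functions is given by \<open>f 0, \<dots>, f (k - 1)\<close>.\<close>

definition lin_comb :: "nat \<Rightarrow> (nat \<Rightarrow> complex) \<Rightarrow> (nat \<Rightarrow> complex \<Rightarrow> complex) \<Rightarrow> complex \<Rightarrow> complex" where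
  "lin_comb k c f z = (\<Sum>j<k. c j * f j z)"

definition lin_indep :: "nat \<Rightarrow> (nat \<Rightarrow> complex \<Rightarrow> complex) \<Rightarrow> bool" where
  "lin_indep k f \<longleftrightarrow>
     (\<forall>c. (\<forall>z\<in>upper_half_plane. lin_comb k c f z = 0) \<longrightarrow> (\<forall>j<k. c j = 0))"

definition wronskian :: "nat \<Rightarrow> (nat \<Rightarrow> complex \<Rightarrow> complex) \<Rightarrow> complex \<Rightarrow> complex" where
  "wronskian k f z = Determinant.det (Matrix.mat k k (\<lambda>(i, j). (deriv ^^ i) (f j) z))"

definition span_orders :: "nat \<Rightarrow> (nat \<Rightarrow> complex \<Rightarrow> complex) \<Rightarrow> complex \<Rightarrow> int set" where
  "span_orders k f \<xi> =
     {zorder \<phi> \<xi> |\<phi>. \<phi> \<in> range (\<lambda>c. lin_comb k c f) \<and> (\<exists>z\<in>upper_half_plane. \<phi> z \<noteq> 0)}"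

text \<open>For \<open>k\<close> linearly independent functions, the set above has exactly \<open>k\<close> elements.\<close>

definition order_sum :: "nat \<Rightarrow> (nat \<Rightarrow> complex \<Rightarrow> complex) \<Rightarrow> complex \<Rightarrow> int" where
  "order_sum k f \<xi> = \<Sum> (span_orders k f \<xi>)"

definition stabilizer :: "(real^2^2) set \<Rightarrow> complex \<Rightarrow> (real^2^2) set" where
  "stabilizer \<Gamma> \<xi> = {\<gamma>\<in>\<Gamma>. moebius \<gamma> \<xi> = \<xi>}"

definition ramification :: "(real^2^2) set \<Rightarrow> complex \<Rightarrow> nat" where
  "ramification \<Gamma> \<xi> =
     order ((SL2R\<lparr>carrier := stabilizer \<Gamma> \<xi>\<rparr>) Mod
       (\<Gamma> \<inter> {Finite_Cartesian_Product.mat 1, Finite_Cartesian_Product.mat (-1)}))"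

text \<open>The order of a form of even weight at the image of \<open>\<xi>\<close> in the quotient surface; it may
  be fractional.\<close>

definition order_at :: "(real^2^2) set \<Rightarrow> (complex \<Rightarrow> complex) \<Rightarrow> complex \<Rightarrow> real" where
  "order_at \<Gamma> f \<xi> = of_int (zorder f \<xi>) / of_nat (ramification \<Gamma> \<xi>)"

end

theory Submission
  imports Defs
begin

text \<open>
  Only the local behaviour at \<open>\<xi>\<close> matters: both sides carry the factor
  \<open>1 / e\<^sub>\<xi>\<close>, so the claim is that the order of vanishing of the Wronskian is
  \<open>n\<^sub>0 + \<dots> + n\<^sub>k\<^sub>-\<^sub>1 - (0 + 1 + \<dots> + (k - 1))\<close>, where the \<open>n\<^sub>j\<close> are the orders that occur in
  the span.

  Passing to Taylor series at \<open>\<xi>\<close> turns this into algebra of formal power series. A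
  unitriangular change of the sequence does not alter the Wronskian, and it can be chosen so
  that the new series \<open>G\<^sub>j\<close> have pairwise different orders \<open>n\<^sub>j\<close>
  (\<open>exists_unitriangular_basis_distinct_orders\<close>). The operator \<open>X\<^sup>i D\<^sup>i\<close> multiplies the
  coefficient of \<open>X\<^sup>n\<close> by the falling factorial \<open>n (n - 1) \<dots> (n - i + 1)\<close>, so it preserves
  divisibility by powers of \<open>X\<close>. Multiplying row \<open>i\<close> of the Wronskian matrix by \<open>X\<^sup>i\<close> therefore
  allows \<open>X\<close> to the power \<open>n\<^sub>j\<close> to be extracted from column \<open>j\<close>. The remaining determinant has, up
  to the leading coefficients of the \<open>G\<^sub>j\<close>, the constant term \<open>det (n\<^sub>j (n\<^sub>j - 1) \<dots> (n\<^sub>j - i + 1))\<close>.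
  This is a Vandermonde determinant in disguise, and it is non-zero because the \<open>n\<^sub>j\<close> are
  different (\<open>falling_factorial_matrix_det_nonzero\<close>). Counting powers of \<open>X\<close> gives
  \<open>fps_wronskian_subdegree\<close>. The identity theorem ensures that linear independence on the
  half-plane survives the passage to Taylor series, which gives \<open>zorder_wronskian\<close>.
\<close>

section \<open>Orders in the span of a sequence of power series\<close>

definition fps_lin_comb :: "nat \<Rightarrow> (nat \<Rightarrow> 'a::comm_ring_1) \<Rightarrow> (nat \<Rightarrow> 'a fps) \<Rightarrow> 'a fps" where
  "fps_lin_comb k c F = (\<Sum>j<k. fps_const (c j) * F j)"

definition fps_span_orders :: "nat \<Rightarrow> (nat \<Rightarrow> 'a::comm_ring_1 fps) \<Rightarrow> nat set" where
  "fps_span_orders k F = {subdegree (fps_lin_comb k c F) |c. fps_lin_comb k c F \<noteq> 0}"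

definition fps_lin_indep :: "nat \<Rightarrow> (nat \<Rightarrow> 'a::comm_ring_1 fps) \<Rightarrow> bool" where
  "fps_lin_indep k F \<longleftrightarrow> (\<forall>c. fps_lin_comb k c F = 0 \<longrightarrow> (\<forall>j<k. c j = 0))"

lemma fps_lin_comb_add_scaled:
  "fps_lin_comb k c F + fps_const a * fps_lin_comb k d F = fps_lin_comb k (\<lambda>j. c j + a * d j) F"
  unfolding fps_lin_comb_def
  by (simp add: sum_distrib_left sum.distrib [symmetric] algebra_simps
      fps_const_add [symmetric] fps_const_mult [symmetric]
      del: fps_const_add fps_const_mult)

lemma fps_lin_comb_Suc:
  "fps_lin_comb (Suc k) c F = fps_lin_comb k c F + fps_const (c k) * F k"
  by (simp add: fps_lin_comb_def)

lemma fps_lin_comb_cong: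
  "(\<And>j. j < k \<Longrightarrow> c j = d j) \<Longrightarrow> fps_lin_comb k c F = fps_lin_comb k d F"
  by (simp add: fps_lin_comb_def)

lemma fps_lin_comb_Suc_upd:
  "fps_lin_comb (Suc k) (c(k := a)) F = fps_lin_comb k c F + fps_const a * F k"
  using fps_lin_comb_cong[of k "c(k := a)" c F] by (simp add: fps_lin_comb_Suc)

lemma fps_lin_indep_Suc_imp:
  assumes "fps_lin_indep (Suc k) F"
  shows "fps_lin_indep k F"
  unfolding fps_lin_indep_def
proof (intro allI impI)
  fix c :: "nat \<Rightarrow> 'a" and j
  assume c: "fps_lin_comb k c F = 0" "j < k"
  hence "fps_lin_comb (Suc k) (c(k := 0)) F = 0"
    by (simp add: fps_lin_comb_Suc_upd)
  hence "(c(k := 0)) j = 0"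
    using assms \<open>j < k\<close> unfolding fps_lin_indep_def by (meson less_SucI)
  thus "c j = 0" using \<open>j < k\<close> by simp
qed

text \<open>
  If the order of some translate of \<open>F k\<close> occurs in the span of the earlier series, then
  cancelling the leading term produces a translate of larger order. Only finitely many orders
  occur in that span, so a translate of maximal order would contradict itself; independence
  keeps the translates from vanishing.
\<close>

lemma exists_translate_of_new_order:
  fixes F :: "nat \<Rightarrow> 'a::field fps"
  assumes indep: "fps_lin_indep (Suc k) F" and fin: "finite (fps_span_orders k F)"
  shows "\<exists>c. subdegree (F k + fps_lin_comb k c F) \<notin> fps_span_orders k F"
proof (rule ccontr)
  assume "\<not> ?thesis"
  hence sub: "subdegree (F k + fps_lin_comb k c F) \<in> fps_span_orders k F" for c by blast
  define T where "T = range (\<lambda>c. subdegree (F k + fps_lin_comb k c F))"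
  have "finite T" using sub fin by (auto simp: T_def intro: finite_subset)
  moreover have "T \<noteq> {}" by (simp add: T_def)
  ultimately have "Max T \<in> T" by (rule Max_in)
  then obtain c where c: "subdegree (F k + fps_lin_comb k c F) = Max T"
    by (auto simp: T_def)
  define G where "G = F k + fps_lin_comb k c F"
  obtain d where d: "fps_lin_comb k d F \<noteq> 0" "subdegree (fps_lin_comb k d F) = subdegree G"
    using sub[of c] unfolding fps_span_orders_def G_def by force
  define P where "P = fps_lin_comb k d F"
  define n where "n = subdegree G"
  have P: "fps_nth P n \<noteq> 0" "\<And>i. i < n \<Longrightarrow> fps_nth P i = 0"
    using d nth_subdegree_nonzero[of P] nth_less_subdegree_zero[of _ P]
    unfolding P_def n_def by metis+
  define a where "a = - (fps_nth G n / fps_nth P n)"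
  define G' where "G' = G + fps_const a * P"
  have G': "G' = F k + fps_lin_comb k (\<lambda>j. c j + a * d j) F"
    unfolding G'_def G_def P_def fps_lin_comb_add_scaled [symmetric] by (simp add: add.assoc)
  have "G' \<noteq> 0"
  proof
    assume "G' = 0"
    hence "fps_lin_comb (Suc k) ((\<lambda>j. c j + a * d j)(k := 1)) F = 0"
      by (simp add: G' fps_lin_comb_Suc_upd add.commute)
    hence "((\<lambda>j. c j + a * d j)(k := 1)) k = 0"
      using indep unfolding fps_lin_indep_def by (meson lessI)
    thus False by simp
  qed
  moreover have "fps_nth G' i = 0" if "i \<le> n" for i
  proof (cases "i = n")
    case True
    thus ?thesis using P(1) by (simp add: G'_def a_def)
  next
    case False
    with that have "i < n" by simp
    thus ?thesis using P(2)[of i] nth_less_subdegree_zero[of i G]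
      by (simp add: G'_def n_def)
  qed
  ultimately have "n < subdegree G'" by (rule subdegree_greaterI)
  moreover have "subdegree G' \<le> Max T"
    using \<open>finite T\<close> by (intro Max_ge) (auto simp: T_def G')
  ultimately show False using c by (simp add: n_def G_def)
qed

text \<open>
  Every element of the larger span is a multiple of the translate plus an element of the smaller
  span. The two summands have different orders, so their leading terms cannot cancel.
\<close>

lemma fps_span_orders_Suc:
  fixes F :: "nat \<Rightarrow> 'a::field fps"
  assumes indep: "fps_lin_indep (Suc k) F"
    and new: "subdegree (F k + fps_lin_comb k c F) \<notin> fps_span_orders k F"
  shows "fps_span_orders (Suc k) F =
    insert (subdegree (F k + fps_lin_comb k c F)) (fps_span_orders k F)"
proof -
  define G where "G = F k + fps_lin_comb k c F"
  have G: "G = fps_lin_comb (Suc k) (c(k := 1)) F"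
    by (simp add: G_def fps_lin_comb_Suc_upd add.commute)
  have "G \<noteq> 0"
  proof
    assume "G = 0"
    hence "(c(k := 1)) k = 0"
      using indep unfolding fps_lin_indep_def G by (meson lessI)
    thus False by simp
  qed
  have "n \<in> insert (subdegree G) (fps_span_orders k F)" if n: "n \<in> fps_span_orders (Suc k) F" for n
  proof -
    obtain d where d: "fps_lin_comb (Suc k) d F \<noteq> 0" "n = subdegree (fps_lin_comb (Suc k) d F)"
      using n by (auto simp: fps_span_orders_def)
    define P where "P = fps_lin_comb k (\<lambda>j. d j + - d k * c j) F"
    have P: "P = 0 \<or> subdegree P \<in> fps_span_orders k F"
      by (auto simp: fps_span_orders_def P_def)
    have eq: "fps_lin_comb (Suc k) d F = fps_const (d k) * G + P"
      unfolding P_def fps_lin_comb_add_scaled [symmetric] G_def fps_lin_comb_Suc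
      by (simp add: algebra_simps fps_const_neg [symmetric] del: fps_const_neg)
    show ?thesis
    proof (cases "d k = 0 \<or> P = 0")
      case True
      thus ?thesis using d P eq by auto
    next
      case False
      hence "subdegree (fps_const (d k) * G) = subdegree G" "fps_const (d k) * G \<noteq> 0"
        using \<open>G \<noteq> 0\<close> by auto
      moreover have "subdegree P \<noteq> subdegree G" using False P new by (auto simp: G_def)
      ultimately have "n = subdegree G \<or> n = subdegree P"
        using False d(2) unfolding eq
        by (metis linorder_neqE_nat subdegree_add_eq1 subdegree_add_eq2)
      thus ?thesis using P False by auto
    qed
  qed
  moreover have "fps_span_orders k F \<subseteq> fps_span_orders (Suc k) F"
  proof
    fix n assume "n \<in> fps_span_orders k F"
    then obtain d where d: "fps_lin_comb k d F \<noteq> 0" "n = subdegree (fps_lin_comb k d F)"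
      by (auto simp: fps_span_orders_def)
    moreover have "fps_lin_comb k d F = fps_lin_comb (Suc k) (d(k := 0)) F"
      by (simp add: fps_lin_comb_Suc_upd)
    ultimately show "n \<in> fps_span_orders (Suc k) F" unfolding fps_span_orders_def by auto
  qed
  moreover have "subdegree G \<in> fps_span_orders (Suc k) F"
    using \<open>G \<noteq> 0\<close> unfolding fps_span_orders_def G by blast
  ultimately show ?thesis unfolding G_def by blast
qed

text \<open>
  Gaussian elimination on the orders. The shape \<open>F j + (combination of earlier terms)\<close> is kept
  because such a change of basis has determinant 1.
\<close>

lemma exists_unitriangular_basis_distinct_orders:
  fixes F :: "nat \<Rightarrow> 'a::field fps"
  assumes "fps_lin_indep k F"
  shows "\<exists>c. inj_on (\<lambda>j. subdegree (F j + fps_lin_comb j (c j) F)) {..<k} \<and>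
    fps_span_orders k F = (\<lambda>j. subdegree (F j + fps_lin_comb j (c j) F)) ` {..<k}"
  using assms
proof (induction k)
  case 0
  show ?case by (simp add: fps_span_orders_def fps_lin_comb_def)
next
  case (Suc k)
  let ?n = "\<lambda>c j. subdegree (F j + fps_lin_comb j (c j) F)"
  obtain c where c: "inj_on (?n c) {..<k}" "fps_span_orders k F = ?n c ` {..<k}"
    using Suc fps_lin_indep_Suc_imp by blast
  obtain b where b: "subdegree (F k + fps_lin_comb k b F) \<notin> fps_span_orders k F"
    using exists_translate_of_new_order[OF Suc.prems] c(2) by auto
  have img: "?n (c(k := b)) ` {..<k} = ?n c ` {..<k}" by auto
  have inj: "inj_on (?n (c(k := b))) {..<k}"
    using c(1) by (simp add: inj_on_def)
  have "inj_on (?n (c(k := b))) (insert k {..<k})"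
    using b inj img by (simp add: c(2) inj_on_insert)
  moreover have "fps_span_orders (Suc k) F = ?n (c(k := b)) ` insert k {..<k}"
    unfolding image_insert img fps_span_orders_Suc[OF Suc.prems b] c(2) by simp
  ultimately show ?case unfolding lessThan_Suc by blast
qed

section \<open>The order of the Wronskian of power series\<close>

definition fps_wronskian :: "nat \<Rightarrow> (nat \<Rightarrow> 'a::comm_ring_1 fps) \<Rightarrow> 'a fps" where
  "fps_wronskian k F = Determinant.det (Matrix.mat k k (\<lambda>(i, j). (fps_deriv ^^ i) (F j)))"

lemma higher_fps_deriv_lin_comb:
  "(fps_deriv ^^ i) (fps_lin_comb k c F) = fps_lin_comb k c (\<lambda>j. (fps_deriv ^^ i) (F j))"
  by (induction i) (simp_all add: fps_lin_comb_def fps_deriv_sum)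

lemma higher_fps_deriv_add:
  "(fps_deriv ^^ i) (F + G) = (fps_deriv ^^ i) F + (fps_deriv ^^ i) G"
  by (induction i) simp_all

lemma fps_wronskian_unitriangular:
  fixes F :: "nat \<Rightarrow> 'a::idom fps"
  shows "fps_wronskian k (\<lambda>j. F j + fps_lin_comb j (c j) F) = fps_wronskian k F"
proof -
  define C where "C = Matrix.mat k k
    (\<lambda>(l, j). if l < j then fps_const (c j l) else if l = j then 1 else 0)"
  define W where "W = Matrix.mat k k (\<lambda>(i, j). (fps_deriv ^^ i) (F j))"
  have C: "C \<in> carrier_mat k k" and W: "W \<in> carrier_mat k k" by (simp_all add: C_def W_def)
  have "Determinant.det C = prod_list (diag_mat C)"
    by (rule det_upper_triangular[OF _ C]) (auto simp: C_def)
  also have "diag_mat C = map (\<lambda>_. 1) [0..<k]"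
    by (auto simp: diag_mat_def C_def)
  also have "prod_list \<dots> = 1" by (induction k) auto
  finally have detC: "Determinant.det C = 1" .
  have "Matrix.mat k k (\<lambda>(i, j). (fps_deriv ^^ i) (F j + fps_lin_comb j (c j) F)) = W * C"
  proof (rule eq_matI)
    fix i j assume "i < dim_row (W * C)" "j < dim_col (W * C)"
    hence ij: "i < k" "j < k" by (simp_all add: W_def C_def)
    let ?D = "fps_deriv ^^ i"
    have "(W * C) $$ (i, j) = (\<Sum>l<k. ?D (F l) *
        (if l < j then fps_const (c j l) else if l = j then 1 else 0))"
      using ij by (simp add: W_def C_def scalar_prod_def lessThan_atLeast0)
    also have "\<dots> = (\<Sum>l<k. (if l < j then fps_const (c j l) * ?D (F l) else 0) +
        (if l = j then ?D (F l) else 0))"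
      by (intro sum.cong) (auto simp: mult.commute)
    also have "\<dots> = (\<Sum>l\<in>{..<k} \<inter> {l. l < j}. fps_const (c j l) * ?D (F l)) + ?D (F j)"
      using ij by (simp add: sum.distrib sum.If_cases)
    also have "{..<k} \<inter> {l. l < j} = {..<j}" using ij by auto
    finally show "Matrix.mat k k (\<lambda>(i, j). (fps_deriv ^^ i) (F j + fps_lin_comb j (c j) F)) $$ (i, j) =
        (W * C) $$ (i, j)"
      using ij by (simp add: higher_fps_deriv_add higher_fps_deriv_lin_comb)
        (simp add: fps_lin_comb_def)
  qed (simp_all add: W_def C_def)
  thus ?thesis
    unfolding fps_wronskian_def W_def [symmetric] by (simp add: det_mult[OF W C] detC)
qed

text \<open>
  The falling factorial vanishes for \<open>n < i\<close>, which is what makes the factor \<open>X\<^sup>i\<close> sufficient to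
  compensate the degrees lost in differentiating.
\<close>

lemma fps_X_power_times_higher_deriv_nth:
  fixes F :: "'a::comm_ring_1 fps"
  shows "fps_nth (fps_X ^ i * (fps_deriv ^^ i) F) n = (\<Prod>t<i. of_nat n - of_nat t) * fps_nth F n"
proof (induction i)
  case (Suc i)
  show ?case
  proof (cases "Suc i \<le> n")
    case True
    hence "fps_nth (fps_X ^ Suc i * (fps_deriv ^^ Suc i) F) n =
        (of_nat n - of_nat i) * fps_nth (fps_X ^ i * (fps_deriv ^^ i) F) n"
      by (simp add: fps_X_power_mult_nth Suc_diff_Suc of_nat_diff del: power_Suc of_nat_Suc)
    thus ?thesis by (simp only: Suc.IH) (simp add: mult_ac)
  next
    case False
    hence "(\<Prod>t<Suc i. of_nat n - of_nat t :: 'a) = 0"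
      by (intro prod_zero) auto
    thus ?thesis using False by (simp add: fps_X_power_mult_nth del: power_Suc)
  qed
qed simp

text \<open>
  Entry \<open>i\<close> of row \<open>j\<close> is the value at \<open>n j\<close> of a monic polynomial of degree \<open>i\<close>. A vector in the
  kernel thus yields a polynomial of degree less than \<open>k\<close> with the \<open>k\<close> roots \<open>n j\<close>. It must be
  zero, and so must its coefficients, since the monic polynomials have different degrees.
\<close>

lemma falling_factorial_matrix_det_nonzero:
  fixes n :: "nat \<Rightarrow> nat"
  assumes "inj_on n {..<k}"
  shows "Determinant.det (Matrix.mat k k
    (\<lambda>(j, i). \<Prod>t<i. of_nat (n j) - of_nat t :: 'a::field_char_0)) \<noteq> 0"
    (is "Determinant.det ?A \<noteq> 0")
proof
  assume "Determinant.det ?A = 0"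
  moreover have A: "?A \<in> carrier_mat k k" by simp
  ultimately obtain v where v: "v \<in> carrier_vec k" "v \<noteq> 0\<^sub>v k" "?A *\<^sub>v v = 0\<^sub>v k"
    using det_0_iff_vec_prod_zero_field[OF A] by blast
  define q :: "nat \<Rightarrow> 'a poly" where "q i = (\<Prod>t<i. [:- of_nat t, 1:])" for i
  define p where "p = (\<Sum>i<k. smult (vec_index v i) (q i))"
  have degq: "degree (q i) = i" for i
    unfolding q_def by (subst degree_prod_eq_sum_degree) auto
  have lcq: "coeff (q i) i = 1" for i
    using lead_coeff_prod[of "\<lambda>t. [:- of_nat t, 1 :: 'a:]" "{..<i}"] degq[of i]
    by (simp add: q_def)
  have root: "poly p (of_nat (n j)) = 0" if "j < k" for j
  proof -
    have "vec_index (?A *\<^sub>v v) j = (\<Sum>i<k. (\<Prod>t<i. of_nat (n j) - of_nat t) * vec_index v i)"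
      using that v(1) by (simp add: scalar_prod_def lessThan_atLeast0)
    also have "\<dots> = poly p (of_nat (n j))"
      by (simp add: p_def q_def poly_sum poly_prod mult.commute)
    finally show ?thesis using v(3) that by simp
  qed
  have "p = 0"
  proof (rule ccontr)
    assume "p \<noteq> 0"
    have "card ((\<lambda>j. of_nat (n j) :: 'a) ` {..<k}) = k"
      using assms by (subst card_image) (auto simp: inj_on_def)
    moreover have "(\<lambda>j. of_nat (n j) :: 'a) ` {..<k} \<subseteq> {x. poly p x = 0}"
      using root by auto
    ultimately have "k \<le> card {x. poly p x = 0}"
      using card_mono[OF poly_roots_finite[OF \<open>p \<noteq> 0\<close>]] by metis
    also have "\<dots> \<le> degree p" using \<open>p \<noteq> 0\<close> by (rule card_poly_roots_bound)
    finally have "k \<le> degree p" .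
    have "k > 0" using \<open>p \<noteq> 0\<close> by (cases k) (auto simp: p_def)
    moreover have "degree (smult (vec_index v i) (q i)) < k" if "i < k" for i
      using degree_smult_le[of "vec_index v i" "q i"] degq[of i] that by simp
    ultimately have "degree p < k"
      unfolding p_def by (intro degree_sum_less) auto
    thus False using \<open>k \<le> degree p\<close> by simp
  qed
  \<comment> \<open>The largest index with a non-zero coefficient would contribute the leading term of \<open>p\<close>.\<close>
  define J where "J = {i. i < k \<and> vec_index v i \<noteq> 0}"
  have "J \<noteq> {}" using v(1,2) by (auto simp: J_def)
  moreover have "finite J" by (simp add: J_def)
  ultimately have M: "Max J \<in> J" by (rule Max_in[rotated])
  have "coeff p (Max J) = (\<Sum>i<k. vec_index v i * coeff (q i) (Max J))"
    by (simp add: p_def coeff_sum)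
  also have "\<dots> = (\<Sum>i<k. if i = Max J then vec_index v i else 0)"
  proof (intro sum.cong refl)
    fix i assume i: "i \<in> {..<k}"
    show "vec_index v i * coeff (q i) (Max J) = (if i = Max J then vec_index v i else 0)"
    proof (cases i "Max J" rule: linorder_cases)
      case less
      thus ?thesis by (simp add: coeff_eq_0 degq)
    next
      case equal
      thus ?thesis by (simp add: lcq)
    next
      case greater
      hence "i \<notin> J" using Max_ge[OF \<open>finite J\<close>, of i] by auto
      hence "vec_index v i = 0" using i by (simp add: J_def)
      thus ?thesis using greater by simp
    qed
  qed
  also have "\<dots> = vec_index v (Max J)" using M by (simp add: J_def)
  finally show False using M \<open>p = 0\<close> by (simp add: J_def)
qed

lemma det_scale_rows_columns:
  fixes A :: "nat \<Rightarrow> nat \<Rightarrow> 'a::comm_ring_1"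
  shows "Determinant.det (Matrix.mat k k (\<lambda>(i, j). a i * b j * A i j)) =
    (\<Prod>i<k. a i) * (\<Prod>j<k. b j) * Determinant.det (Matrix.mat k k (\<lambda>(i, j). A i j))"
proof -
  have "(\<Prod>i = 0..<k. a i * b (p i) * A i (p i)) =
      (\<Prod>i<k. a i) * (\<Prod>j<k. b j) * (\<Prod>i = 0..<k. A i (p i))"
    if "p permutes {0..<k}" for p
    using prod.permute[OF that, of b] by (simp add: prod.distrib o_def lessThan_atLeast0)
  moreover have "Matrix.mat k k (\<lambda>(i, j). B i j) $$ (i, p i) = B i (p i)"
    if "p permutes {0..<k}" "i \<in> {0..<k}" for p i and B :: "nat \<Rightarrow> nat \<Rightarrow> 'a"
    using that permutes_in_image[OF that(1), of i] by simp
  ultimately show ?thesis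
    by (simp add: det_def'[of _ k] sum_distrib_left mult_ac)
qed

text \<open>
  The case of different orders: the lowest possible coefficient of the Wronskian is a product of
  leading coefficients with a non-zero falling factorial determinant. The sum
  \<open>0 + \<dots> + (k - 1)\<close> stays on the left to avoid truncated subtraction.
\<close>

lemma fps_wronskian_subdegree_distinct:
  fixes G :: "nat \<Rightarrow> 'a::field_char_0 fps"
  assumes inj: "inj_on (\<lambda>j. subdegree (G j)) {..<k}" and nz: "\<And>j. j < k \<Longrightarrow> G j \<noteq> 0"
  shows "fps_wronskian k G \<noteq> 0"
    and "subdegree (fps_wronskian k G) + (\<Sum>i<k. i) = (\<Sum>j<k. subdegree (G j))"
proof -
  define n where "n j = subdegree (G j)" for j
  define ff where "ff m i = (\<Prod>t<i. of_nat m - of_nat t :: 'a)" for m i :: nat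
  define U where "U i j = Abs_fps (\<lambda>l. ff (l + n j) i * fps_nth (G j) (l + n j))" for i j
  \<comment> \<open>Coefficients of \<open>X\<^sup>i D\<^sup>i G\<^sub>j\<close> below \<open>n j\<close> vanish, and \<open>U i j\<close> is the quotient by that power of \<open>X\<close>.
    The factors 1 match the general form of \<open>det_scale_rows_columns\<close>.\<close>
  have factor: "fps_X ^ i * 1 * (fps_deriv ^^ i) (G j) = 1 * fps_X ^ n j * U i j" for i j
  proof (rule fps_ext)
    fix l
    show "fps_nth (fps_X ^ i * 1 * (fps_deriv ^^ i) (G j)) l = fps_nth (1 * fps_X ^ n j * U i j) l"
      by (simp only: mult_1_left mult_1_right fps_X_power_times_higher_deriv_nth)
        (auto simp: fps_X_power_mult_nth U_def ff_def n_def)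
  qed
  have main: "fps_X ^ (\<Sum>i<k. i) * fps_wronskian k G =
      fps_X ^ (\<Sum>j<k. n j) * Determinant.det (Matrix.mat k k (\<lambda>(i, j). U i j))"
    unfolding fps_wronskian_def power_sum
    using det_scale_rows_columns[of k "\<lambda>i. fps_X ^ i" "\<lambda>_. 1" "\<lambda>i j. (fps_deriv ^^ i) (G j)"]
      det_scale_rows_columns[of k "\<lambda>_. 1" "\<lambda>j. fps_X ^ n j" U]
    by (simp only: factor) simp
  interpret h: comm_ring_hom "\<lambda>F :: 'a fps. fps_nth F 0"
    by unfold_locales simp_all
  have "fps_nth (Determinant.det (Matrix.mat k k (\<lambda>(i, j). U i j))) 0 =
      Determinant.det (Matrix.mat k k (\<lambda>(i, j). 1 * fps_nth (G j) (n j) * ff (n j) i))"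
    unfolding h.hom_det [symmetric]
    by (intro arg_cong[of _ _ Determinant.det] eq_matI) (auto simp: U_def)
  also have "\<dots> = (\<Prod>j<k. fps_nth (G j) (n j)) *
      Determinant.det (Matrix.mat k k (\<lambda>(i, j). ff (n j) i))"
    by (subst det_scale_rows_columns) simp
  also have "Determinant.det (Matrix.mat k k (\<lambda>(i, j). ff (n j) i)) =
      Determinant.det (Matrix.mat k k (\<lambda>(j, i). ff (n j) i))"
  proof -
    have "transpose_mat (Matrix.mat k k (\<lambda>(j, i). ff (n j) i)) =
        Matrix.mat k k (\<lambda>(i, j). ff (n j) i)"
      by (rule eq_matI) auto
    thus ?thesis
      using Determinant.det_transpose[of "Matrix.mat k k (\<lambda>(j, i). ff (n j) i)" k] by simp
  qed
  finally have "fps_nth (Determinant.det (Matrix.mat k k (\<lambda>(i, j). U i j))) 0 =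
      (\<Prod>j<k. fps_nth (G j) (n j)) *
      Determinant.det (Matrix.mat k k (\<lambda>(j, i). ff (n j) i))" .
  moreover have "Determinant.det (Matrix.mat k k (\<lambda>(j, i). ff (n j) i)) \<noteq> 0"
    unfolding ff_def using inj by (intro falling_factorial_matrix_det_nonzero) (simp add: n_def)
  ultimately have U0: "fps_nth (Determinant.det (Matrix.mat k k (\<lambda>(i, j). U i j))) 0 \<noteq> 0"
    using nz by (simp add: n_def)
  hence dU: "Determinant.det (Matrix.mat k k (\<lambda>(i, j). U i j)) \<noteq> 0" by auto
  show W: "fps_wronskian k G \<noteq> 0" using main dU by auto
  have "subdegree (fps_X ^ (\<Sum>i<k. i) * fps_wronskian k G) = (\<Sum>i<k. i) + subdegree (fps_wronskian k G)"
    using W by (simp add: fps_X_power_subdegree)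
  moreover have "subdegree (fps_X ^ (\<Sum>j<k. n j) * Determinant.det (Matrix.mat k k (\<lambda>(i, j). U i j)))
      = (\<Sum>j<k. n j)"
    using dU U0 by (simp add: fps_X_power_subdegree)
  ultimately show "subdegree (fps_wronskian k G) + (\<Sum>i<k. i) = (\<Sum>j<k. subdegree (G j))"
    using main by (simp add: n_def)
qed

text \<open>
  The general case reduces to different orders, as both the Wronskian and the span are
  unchanged by the unitriangular change of basis.
\<close>

theorem fps_wronskian_subdegree:
  fixes F :: "nat \<Rightarrow> 'a::field_char_0 fps"
  assumes indep: "fps_lin_indep k F"
  shows "fps_wronskian k F \<noteq> 0"
    and "subdegree (fps_wronskian k F) + (\<Sum>i<k. i) = \<Sum> (fps_span_orders k F)"
proof -
  obtain c where c: "inj_on (\<lambda>j. subdegree (F j + fps_lin_comb j (c j) F)) {..<k}"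
      "fps_span_orders k F = (\<lambda>j. subdegree (F j + fps_lin_comb j (c j) F)) ` {..<k}"
    using exists_unitriangular_basis_distinct_orders[OF indep] by blast
  define G where "G j = F j + fps_lin_comb j (c j) F" for j
  have W: "fps_wronskian k G = fps_wronskian k F"
    unfolding G_def by (rule fps_wronskian_unitriangular)
  have nz: "G j \<noteq> 0" if "j < k" for j
  proof
    assume "G j = 0"
    define d where "d l = (if l < j then c j l else if l = j then 1 else 0)" for l
    have "fps_lin_comb k d F = (\<Sum>l<Suc j. fps_const (d l) * F l)"
      unfolding fps_lin_comb_def using that
      by (intro sum.mono_neutral_right) (auto simp: d_def)
    also have "\<dots> = G j"
      by (simp add: G_def d_def fps_lin_comb_def add.commute)
    finally have "fps_lin_comb k d F = 0" using \<open>G j = 0\<close> by simp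
    hence "d j = 0" using indep that by (auto simp: fps_lin_indep_def)
    thus False by (simp add: d_def)
  qed
  have inj: "inj_on (\<lambda>j. subdegree (G j)) {..<k}" using c(1) by (simp add: G_def)
  show "fps_wronskian k F \<noteq> 0"
    using fps_wronskian_subdegree_distinct(1)[OF inj nz] by (simp add: W)
  have "\<Sum> (fps_span_orders k F) = (\<Sum>j<k. subdegree (G j))"
    unfolding c(2) G_def [symmetric] by (simp add: sum.reindex[OF inj])
  thus "subdegree (fps_wronskian k F) + (\<Sum>i<k. i) = \<Sum> (fps_span_orders k F)"
    using fps_wronskian_subdegree_distinct(2)[OF inj nz] by (simp only: W)
qed

section \<open>From holomorphic functions to Taylor series\<close>

lemma fps_expansion_higher_deriv:
  "fps_expansion ((deriv ^^ i) f) z = (fps_deriv ^^ i) (fps_expansion f z)"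
proof (induction i)
  case (Suc i)
  have "fps_expansion (deriv g) z = fps_deriv (fps_expansion g z)" for g :: "complex \<Rightarrow> complex"
  proof (rule fps_ext)
    fix n
    have "of_nat (Suc n) * (deriv ^^ n) (deriv g) z / (of_nat (Suc n) * fact n) =
        (deriv ^^ n) (deriv g) z / fact n"
      by (rule mult_divide_mult_cancel_left) (simp del: of_nat_Suc)
    thus "fps_nth (fps_expansion (deriv g) z) n = fps_nth (fps_deriv (fps_expansion g z)) n"
      by (simp only: fps_expansion_def fps_nth_Abs_fps fps_deriv_nth Suc_eq_plus1 [symmetric]
          funpow_Suc_right o_apply fact_Suc times_divide_eq_right)
  qed
  thus ?case using Suc by simp
qed simp

text \<open>
  Taylor expansion at \<open>\<xi>\<close> is a ring homomorphism that commutes with differentiation, so it can be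
  pushed through the Leibniz formula for the determinant.
\<close>

lemma wronskian_has_fps_expansion:
  assumes "\<And>j. j < k \<Longrightarrow> f j analytic_on {\<xi>}"
  shows "(\<lambda>w. wronskian k f (\<xi> + w)) has_fps_expansion
    fps_wronskian k (\<lambda>j. fps_expansion (f j) \<xi>)"
proof -
  have entry: "(\<lambda>w. (deriv ^^ i) (f j) (\<xi> + w)) has_fps_expansion
      (fps_deriv ^^ i) (fps_expansion (f j) \<xi>)" if "j < k" for i j
    using analytic_at_imp_has_fps_expansion[OF analytic_higher_deriv[OF assms[OF that]], of i]
    by (simp add: fps_expansion_higher_deriv)
  have perm: "p i < k" if "p permutes {0..<k}" "i < k" for p i
    using permutes_in_image[OF that(1), of i] that(2) by simp
  have "(\<lambda>w. \<Sum>p | p permutes {0..<k}. signof p * (\<Prod>i = 0..<k. (deriv ^^ i) (f (p i)) (\<xi> + w)))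
    has_fps_expansion
      (\<Sum>p | p permutes {0..<k}. fps_const (signof p) *
        (\<Prod>i = 0..<k. (fps_deriv ^^ i) (fps_expansion (f (p i)) \<xi>)))"
    by (intro has_fps_expansion_sum has_fps_expansion_cmult_left has_fps_expansion_prod entry)
      (simp add: perm)
  also have "(\<lambda>w. \<Sum>p | p permutes {0..<k}. signof p * (\<Prod>i = 0..<k. (deriv ^^ i) (f (p i)) (\<xi> + w))) =
      (\<lambda>w. wronskian k f (\<xi> + w))"
    by (auto simp: wronskian_def det_def'[of _ k] perm fun_eq_iff intro!: sum.cong prod.cong)
  also have "(\<Sum>p | p permutes {0..<k}. fps_const (signof p) *
        (\<Prod>i = 0..<k. (fps_deriv ^^ i) (fps_expansion (f (p i)) \<xi>))) =
      fps_wronskian k (\<lambda>j. fps_expansion (f j) \<xi>)"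
    by (auto simp: fps_wronskian_def det_def'[of _ k] sign_def perm intro!: sum.cong prod.cong)
  finally show ?thesis .
qed

lemma lin_comb_has_fps_expansion:
  assumes "\<And>j. j < k \<Longrightarrow> f j analytic_on {\<xi>}"
  shows "(\<lambda>w. lin_comb k c f (\<xi> + w)) has_fps_expansion
    fps_lin_comb k c (\<lambda>j. fps_expansion (f j) \<xi>)"
  unfolding lin_comb_def fps_lin_comb_def
  by (intro has_fps_expansion_sum has_fps_expansion_cmult_left
      analytic_at_imp_has_fps_expansion assms) simp

text \<open>
  The identity theorem, which translates linear independence on all of \<open>S\<close> into linear
  independence of the Taylor series at one point.
\<close>

lemma fps_expansion_eq_0_iff:
  assumes "f holomorphic_on S" "open S" "connected S" "\<xi> \<in> S"
    and F: "(\<lambda>w. f (\<xi> + w)) has_fps_expansion F"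
  shows "F = 0 \<longleftrightarrow> (\<forall>z\<in>S. f z = 0)"
proof
  have F_eq: "F = fps_expansion f \<xi>"
    using assms by (intro fps_expansion_unique_complex[OF F] analytic_at_imp_has_fps_expansion)
      (auto simp: analytic_at)
  show "\<forall>z\<in>S. f z = 0" if "F = 0"
  proof
    fix z assume "z \<in> S"
    have *: "(deriv ^^ n) f \<xi> = 0" for n
      using that by (auto simp: F_eq fps_eq_iff fps_expansion_def)
    show "f z = 0"
      by (rule holomorphic_fun_eq_0_on_connected[OF assms(1-3) * assms(4) \<open>z \<in> S\<close>])
  qed
  assume *: "\<forall>z\<in>S. f z = 0"
  have "(deriv ^^ n) f \<xi> = 0" for n
    using higher_deriv_transform_within_open[of f S "\<lambda>_. 0" \<xi> n] assms * by simp
  thus "F = 0" by (simp add: F_eq fps_eq_iff fps_expansion_def)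
qed

section \<open>The order of the Wronskian at a point of the upper half-plane\<close>

theorem zorder_wronskian:
  assumes hol: "\<And>j. j < k \<Longrightarrow> f j holomorphic_on upper_half_plane"
    and indep: "lin_indep k f" and \<xi>: "\<xi> \<in> upper_half_plane"
  shows "zorder (wronskian k f) \<xi> + int (\<Sum>i<k. i) = order_sum k f \<xi>"
proof -
  let ?H = upper_half_plane
  have H: "open ?H" "connected ?H"
    unfolding upper_half_plane_def
    by (auto simp: open_halfspace_Im_gt convex_halfspace_Im_gt intro: convex_connected)
  define F where "F j = fps_expansion (f j) \<xi>" for j
  have ana: "f j analytic_on {\<xi>}" if "j < k" for j
    using hol[OF that] H \<xi> by (auto simp: analytic_at)
  have exp: "(\<lambda>w. lin_comb k c f (\<xi> + w)) has_fps_expansion fps_lin_comb k c F" for c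
    unfolding F_def by (rule lin_comb_has_fps_expansion[OF ana])
  have hol_lc: "lin_comb k c f holomorphic_on ?H" for c
    using hol unfolding lin_comb_def by (intro holomorphic_intros) auto
  have zero_iff: "fps_lin_comb k c F = 0 \<longleftrightarrow> (\<forall>z\<in>?H. lin_comb k c f z = 0)" for c
    by (rule fps_expansion_eq_0_iff[OF hol_lc H \<xi> exp])
  have indepF: "fps_lin_indep k F"
    using indep by (simp add: fps_lin_indep_def lin_indep_def zero_iff)
  have "span_orders k f \<xi> = {zorder (lin_comb k c f) \<xi> |c. fps_lin_comb k c F \<noteq> 0}"
    by (auto simp: span_orders_def zero_iff)
  also have "\<dots> = {int (subdegree (fps_lin_comb k c F)) |c. fps_lin_comb k c F \<noteq> 0}"
    using has_fps_expansion_zorder[OF exp] by metis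
  also have "\<dots> = int ` fps_span_orders k F"
    by (auto simp: fps_span_orders_def)
  finally have "order_sum k f \<xi> = int (\<Sum> (fps_span_orders k F))"
    by (simp add: order_sum_def sum.reindex)
  moreover have "zorder (wronskian k f) \<xi> = int (subdegree (fps_wronskian k F))"
    using wronskian_has_fps_expansion[OF ana] fps_wronskian_subdegree(1)[OF indepF]
    unfolding F_def by (intro has_fps_expansion_zorder)
  ultimately show ?thesis
    using fps_wronskian_subdegree(2)[OF indepF] by (metis of_nat_add)
qed

theorem proposition7p2:
  fixes \<Gamma> :: "(real^2^2) set" and m k :: nat
    and f :: "nat \<Rightarrow> complex \<Rightarrow> complex" and \<xi> :: complex
  assumes "fuchsian_first_kind \<Gamma>"
    and "m \<ge> 2" and "even m"
    and "k \<ge> 1"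
    and "\<forall>j<k. f j \<in> modular_forms m \<Gamma>"
    and "lin_indep k f"
    and "\<xi> \<in> upper_half_plane"
  shows "order_at \<Gamma> (wronskian k f) \<xi> =
    1 / real (ramification \<Gamma> \<xi>) * (real_of_int (order_sum k f \<xi>) - real k * (real k - 1) / 2)"
proof -
  have "real (\<Sum>i<k. i) = real k * (real k - 1) / 2"
    by (induction k) (auto simp: field_simps)
  moreover have "zorder (wronskian k f) \<xi> + int (\<Sum>i<k. i) = order_sum k f \<xi>"
    using assms by (intro zorder_wronskian) (auto simp: modular_forms_def)
  ultimately show ?thesis
    by (simp add: order_at_def flip: \<open>_ = order_sum k f \<xi>\<close>)
qed

end
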